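(* Let $U_1,\ldots,U_n$ be closed linear subspaces of a real Hilbert space $\mathcal H$, $A_i=N_{U_i}$ for $i=1,\ldots,n$, and $U=U_1\cap\cdots\cap U_n$. Let $G=(\mathcal N,\mathcal E)$ be an algorithmic graph of order $n\ge2$, $G'=(\mathcal N,\mathcal E')$ a connected spanning subgraph of $G$, and $Z\in\mathbb R^{n\times(n-1)}$ with $\operatorname{Lap}(G')=ZZ^*$. Let $\theta\in\,]0,2[$, $\boldsymbol v^0\in\mathcal H^{n-1}$, and let $(\boldsymbol x^k)$, $(\boldsymbol v^k)$ be generated, for $k=0,1,2,\ldots$, by $$x_i^{k+1}=J_{\frac1{d_i}A_i}\Big(\frac2{d_i}\sum_{(h,i)\in\mathcal E}x_h^{k+1}+\frac1{d_i}\sum_{j=1}^{n-1}Z_{i,j}v_j^k\Big),\quad i=1,\ldots,n,$$ $$v_i^{k+1}=v_i^k-\theta\sum_{j=1}^nZ_{j,i}x_j^{k+1},\quad i=1,\ldots,n-1.$$ Let $\boldsymbol\alpha=Z^\dagger\boldsymbol\delta$, let $E=Z_\otimes^\dagger(\mathcal U^\perp\cap\Delta_n^\perp)$, and set $$\widetilde u:=\tfrac1{\|\boldsymbol\alpha\|^2}P_U\big(\boldsymbol\alpha_\otimes^*\boldsymbol v^0\big),\qquad \widetilde{\boldsymbol e}:=P_E(\boldsymbol v^0).$$ Then: (i) for each $i=1,\ldots,n$, the sequence $(x_i^k)_k$ converges strongly to $\widetilde u$; (ii) for each $i=1,\ldots,n-1$, the sequence $(v_i^k)_k$ converges strongly to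 $\alpha_i\widetilde u+\widetilde e_i$.
   Context: $\mathcal H^m$ carries the inner product $\langle\boldsymbol x,\boldsymbol y\rangle=\sum_i\langle x_i,y_i\rangle$. $N_{U_i}(x)=U_i^\perp$ if $x\in U_i$ and $\emptyset$ otherwise (normal cone). $J_A=(\mathrm{Id}+A)^{-1}$ is the resolvent. $P_S$ is the orthogonal projection onto a closed linear subspace $S$. Graphs: an algorithmic graph of order $n\ge2$ is a directed graph $G=(\mathcal N,\mathcal E)$ with $\mathcal N=\{1,\ldots,n\}$, $\mathcal E\subseteq\mathcal N\times\mathcal N$, $(i,j)\in\mathcal E\Rightarrow i<j$, and $G$ connected (ignoring edge directions). $G'$ is a spanning subgraph of $G$ if $\mathcal E'\subseteq\mathcal E$. $d_i^{\rm in}=|\{j:(j,i)\in\mathcal E\}|$, $d_i^{\rm out}=|\{j:(i,j)\in\mathcal E\}|$, $d_i=d_i^{\rm in}+d_i^{\rm out}$ are the degrees in $G$. The Laplacian of a graph is the $n\times n$ matrix with the degrees of that graph on the diagonal, $-1$ in entry $(i,j)$ if $i,j$ are adjacent (i.e. $(i,j)$ or $(j,i)$ is an edge), and $0$ otherwise. The degree balance of $G$ is $\boldsymbol\delta\in\mathbb R^n$, $\delta_i=d_i^{\rm out}-d_i^{\rm in}$. Notation: for $K\in\mathbb R^{m\times p}$, $K_\otimes:\mathcal H^p\to\mathcal H^m$, $(K_\otimes\boldsymbol x)_i=\sum_jK_{i,j}x_j$; for $\boldsymbol\beta\in\mathbb R^m$, $\boldsymbol\beta_\otimes^*\boldsymbol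 v=\sum_j\beta_jv_j$. $Z^\dagger$ is the Moore--Penrose inverse and $Z_\otimes^\dagger=(Z^\dagger)_\otimes$. $\Delta_n=\{(x,\ldots,x)\in\mathcal H^n\mid x\in\mathcal H\}$, $\mathcal U=U_1\times\cdots\times U_n\subseteq\mathcal H^n$. $E$ is a closed linear subspace of $\mathcal H^{n-1}$ and $\boldsymbol\alpha\neq0$. *)

theory Defs
  imports "HOL-Analysis.Analysis"
begin

text \<open>
  Real Hilbert spaces are types of class \<open>{real_inner, complete_space}\<close>.  The index set
  \<open>{1,...,n}\<close> is a type \<open>'n\<close> of class \<open>{finite, linorder}\<close> with \<open>n = CARD('n)\<close>, and \<open>'a ^ 'n\<close>
  is the product Hilbert space \<open>H^n\<close>; the library inner product on it is the sum of the
  componentwise ones.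
\<close>

subsection \<open>Algorithmic graphs\<close>

definition connected_graph :: "('n \<times> 'n) set \<Rightarrow> bool" where
  "connected_graph \<E> \<longleftrightarrow> (\<forall>i j. (i, j) \<in> (\<E> \<union> \<E>\<inverse>)\<^sup>*)"

definition algorithmic_graph :: "('n::{finite,linorder} \<times> 'n) set \<Rightarrow> bool" where
  "algorithmic_graph \<E> \<longleftrightarrow>
     CARD('n) \<ge> 2 \<and> (\<forall>i j. (i, j) \<in> \<E> \<longrightarrow> i < j) \<and> connected_graph \<E>"

definition in_deg :: "('n \<times> 'n) set \<Rightarrow> 'n \<Rightarrow> nat" where
  "in_deg \<E> i = card {j. (j, i) \<in> \<E>}"

definition out_deg :: "('n \<times> 'n) set \<Rightarrow> 'n \<Rightarrow> nat" where
  "out_deg \<E> i = card {j. (i, j) \<in> \<E>}"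

definition deg :: "('n \<times> 'n) set \<Rightarrow> 'n \<Rightarrow> nat" where
  "deg \<E> i = in_deg \<E> i + out_deg \<E> i"

definition degree_balance :: "('n::finite \<times> 'n) set \<Rightarrow> real ^ 'n" where
  "degree_balance \<E> = (\<chi> i. real (out_deg \<E> i) - real (in_deg \<E> i))"

definition Lap :: "('n::finite \<times> 'n) set \<Rightarrow> real ^ 'n ^ 'n" where
  "Lap \<E> = (\<chi> i j. if i = j then real (deg \<E> i)
                 else if (i, j) \<in> \<E> \<or> (j, i) \<in> \<E> then -1 else 0)"

subsection \<open>Matrices acting on products of a Hilbert space\<close>

definition lift_mat :: "real ^ 'p ^ 'm \<Rightarrow> 'a::real_vector ^ 'p \<Rightarrow> 'a ^ 'm" where
  "lift_mat K x = (\<chi> i. \<Sum>j\<in>UNIV. K $ i $ j *\<^sub>R x $ j)"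

definition lift_adj :: "real ^ 'm \<Rightarrow> 'a::real_vector ^ 'm \<Rightarrow> 'a" where
  "lift_adj \<beta> v = (\<Sum>j\<in>UNIV. \<beta> $ j *\<^sub>R v $ j)"

text \<open>The Moore--Penrose inverse is the unique solution of the four Penrose equations.\<close>

definition is_moore_penrose :: "real ^ 'p ^ 'm \<Rightarrow> real ^ 'm ^ 'p \<Rightarrow> bool" where
  "is_moore_penrose Z X \<longleftrightarrow>
     Z ** X ** Z = Z \<and> X ** Z ** X = X \<and>
     transpose (Z ** X) = Z ** X \<and> transpose (X ** Z) = X ** Z"

definition moore_penrose :: "real ^ 'p ^ 'm \<Rightarrow> real ^ 'm ^ 'p" where
  "moore_penrose Z = (THE X. is_moore_penrose Z X)"

subsection \<open>Subspaces, projections and set-valued operators\<close>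

definition orth_proj :: "'a::real_inner set \<Rightarrow> 'a \<Rightarrow> 'a" where
  "orth_proj S x = (THE y. y \<in> S \<and> x - y \<in> S\<^sup>\<bottom>)"

definition diagonal_space :: "('a ^ 'n) set" where
  "diagonal_space = range (\<lambda>x. \<chi> i. x)"

definition product_space :: "('n \<Rightarrow> 'a set) \<Rightarrow> ('a ^ 'n) set" where
  "product_space U = {x. \<forall>i. x $ i \<in> U i}"

definition normal_cone :: "'a::real_inner set \<Rightarrow> 'a \<Rightarrow> 'a set" where
  "normal_cone U x = (if x \<in> U then U\<^sup>\<bottom> else {})"

definition op_scale :: "real \<Rightarrow> ('a \<Rightarrow> 'a::real_vector set) \<Rightarrow> 'a \<Rightarrow> 'a set" where
  "op_scale c A x = (\<lambda>u. c *\<^sub>R u) ` A x"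

definition op_inverse :: "('a \<Rightarrow> 'b set) \<Rightarrow> 'b \<Rightarrow> 'a set" where
  "op_inverse A y = {x. y \<in> A x}"

text \<open>
  For maximal monotone \<open>A\<close>, such as positive multiples of normal cones of closed subspaces,
  the set-valued operator \<open>(Id + A)\<^sup>-\<^sup>1\<close> has singleton values and \<open>resolvent A\<close> is the
  corresponding function.
\<close>

definition resolvent :: "('a \<Rightarrow> 'a::real_vector set) \<Rightarrow> 'a \<Rightarrow> 'a" where
  "resolvent A z = the_elem (op_inverse (\<lambda>x. {x + u |u. u \<in> A x}) z)"

end

theory Submission
  imports Defs
begin

text \<open>
  The resolvent of a scaled normal cone is an orthogonal projection, so one step of the algorithm is
  linear: the sweep through the vertices computes \<open>x = S v\<close>, and \<open>v\<close> is replaced by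
  \<open>v - \<theta> R v\<close> with \<open>R = Z\<^sup>T S\<close>, the \<open>displacement\<close>.

  The operator \<open>R\<close> is firmly nonexpansive.  Each sweep satisfies
  \<open>\<langle>R v, v\<rangle> = \<Sum>\<^sub>\<E> \<parallel>x\<^sub>i - x\<^sub>j\<parallel>\<^sup>2\<close>, whereas \<open>Z Z\<^sup>T = Lap \<E>'\<close> gives
  \<open>\<parallel>R v\<parallel>\<^sup>2 = \<Sum>\<^sub>\<E>\<^sub>' \<parallel>x\<^sub>i - x\<^sub>j\<parallel>\<^sup>2\<close>, a sum over a subset of the edges
  (\<open>displacement_firmly_nonexpansive\<close>).  For such an \<open>R\<close> and \<open>0 < \<theta> < 2\<close> the iterates converge
  strongly to the projection of \<open>v 0\<close> onto the kernel of \<open>R\<close>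
  (\<open>relaxed_linear_iteration_tendsto\<close>).

  It remains to know this kernel.  If \<open>R v = 0\<close>, connectedness of \<open>\<E>'\<close> makes the sweep
  constant, \<open>x = (u, ..., u)\<close> with \<open>u\<close> in every \<open>U i\<close>, and the projection equations become
  \<open>Z v = \<delta> \<otimes> u + w\<close> with \<open>w\<^sub>i \<in> (U i)\<^sup>\<bottom>\<close>.  As \<open>Z\<close> is injective with range the vectors of zero
  sum, this means \<open>v = \<alpha> \<otimes> u + e\<close> with \<open>e \<in> E\<close>, an orthogonal decomposition in which \<open>\<alpha>\<close> appears
  as \<open>balance_coeff\<close> and \<open>E\<close> as \<open>kernel_part\<close>
  (\<open>displacement_zero_imp\<close>, \<open>inner_tensor_kernel_part\<close>).  The projection of \<open>v 0\<close> is therefore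
  computed summand by summand (\<open>projection_onto_kernel\<close>), and continuity of the sweep carries the
  limit over to \<open>x\<close> (\<open>sweep_tendsto\<close>).
\<close>

section \<open>Orthogonal projections in a Hilbert space\<close>

lemma orthogonal_comp_iff: "y \<in> S\<^sup>\<bottom> \<longleftrightarrow> (\<forall>s\<in>S. inner s y = 0)"
  by (auto simp: orthogonal_comp_def orthogonal_def)

text \<open>
  First-order optimality in disguise: a quadratic in \<open>t\<close> with minimum at \<open>t = 0\<close> has no
  linear term.  It turns minimality of a distance into orthogonality.
\<close>

lemma inner_nonneg_quadratic_imp_zero:
  fixes b c :: real
  assumes "\<And>t. 0 \<le> 2 * t * b + t\<^sup>2 * c"
  shows "b = 0"
proof (rule ccontr)
  assume b: "b \<noteq> 0"
  define d where "d = \<bar>c\<bar> + 1"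
  have d: "d > 0" "c < d" by (auto simp: d_def)
  \<comment> \<open>The minimiser of the majorant \<open>2 * t * b + t\<^sup>2 * d\<close>, whose value there is negative.\<close>
  have "0 \<le> 2 * (- b / d) * b + (- b / d)\<^sup>2 * c" by (rule assms)
  also have "\<dots> \<le> 2 * (- b / d) * b + (- b / d)\<^sup>2 * d"
    using d by (intro add_left_mono mult_left_mono) auto
  also have "\<dots> = - (b\<^sup>2 / d)"
    using d by (simp add: field_simps power2_eq_square)
  also have "\<dots> < 0" using b d by simp
  finally show False by simp
qed

text \<open>
  The projection theorem.  The parallelogram law, applied to two points of the subspace whose
  midpoint is again in the subspace, makes every minimising sequence of the distance Cauchy;
  its limit is the foot of the perpendicular.
\<close>

lemma orthogonal_decomposition_exists:
  fixes S :: "'b::{real_inner,complete_space} set"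
  assumes S: "subspace S" and cl: "closed S"
  shows "\<exists>y. y \<in> S \<and> x - y \<in> S\<^sup>\<bottom>"
proof -
  define D where "D = Inf ((\<lambda>y. (norm (x - y))\<^sup>2) ` S)"
  have S0: "0 \<in> S" using S by (rule subspace_0)
  have bdd: "bdd_below ((\<lambda>y. (norm (x - y))\<^sup>2) ` S)"
    by (rule bdd_belowI[of _ 0]) auto
  have D_le: "D \<le> (norm (x - y))\<^sup>2" if "y \<in> S" for y
    unfolding D_def using that by (intro cInf_lower bdd) auto
  have "\<exists>y\<in>S. (norm (x - y))\<^sup>2 < D + inverse (real (Suc k))" for k
    using cInf_lessD[of "(\<lambda>y. (norm (x - y))\<^sup>2) ` S" "D + inverse (real (Suc k))"] S0
    by (force simp: D_def)
  then obtain y where yS: "\<And>k. y k \<in> S"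
    and y: "\<And>k. (norm (x - y k))\<^sup>2 < D + inverse (real (Suc k))"
    by metis
  have close: "(norm (y k - y l))\<^sup>2 \<le> 2 * inverse (real (Suc k)) + 2 * inverse (real (Suc l))" for k l
  proof -
    have "(1/2) *\<^sub>R (y k + y l) \<in> S"
      using S yS by (intro subspace_scale subspace_add)
    then have "D \<le> (norm (x - (1/2) *\<^sub>R (y k + y l)))\<^sup>2" by (rule D_le)
    moreover have "(norm (y k - y l))\<^sup>2 + 4 * (norm (x - (1/2) *\<^sub>R (y k + y l)))\<^sup>2
        = 2 * (norm (x - y k))\<^sup>2 + 2 * (norm (x - y l))\<^sup>2"
      unfolding power2_norm_eq_inner by (simp add: algebra_simps inner_commute)
    ultimately show ?thesis using y[of k] y[of l] by linarith
  qed
  have "Cauchy y"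
  proof (rule metric_CauchyI)
    fix e :: real assume e: "0 < e"
    then obtain N where N: "inverse (real (Suc N)) < e\<^sup>2 / 4"
      using reals_Archimedean[of "e\<^sup>2/4"] by auto
    have "dist (y k) (y l) < e" if "N \<le> k" "N \<le> l" for k l
    proof -
      have "inverse (real (Suc k)) \<le> inverse (real (Suc N))"
           "inverse (real (Suc l)) \<le> inverse (real (Suc N))"
        using that by (auto simp: field_simps)
      with close[of k l] N have "(norm (y k - y l))\<^sup>2 < e\<^sup>2" by linarith
      then show ?thesis using e by (simp add: dist_norm power2_less_imp_less)
    qed
    then show "\<exists>M. \<forall>m\<ge>M. \<forall>n\<ge>M. dist (y m) (y n) < e" by blast
  qed
  then obtain p where p: "y \<longlonglongrightarrow> p"
    using Cauchy_convergent convergent_def by blast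
  have pS: "p \<in> S" using closed_sequentially[OF cl] yS p by blast
  have "(norm (x - p))\<^sup>2 \<le> D"
  proof (rule LIMSEQ_le)
    show "(\<lambda>k. (norm (x - y k))\<^sup>2) \<longlonglongrightarrow> (norm (x - p))\<^sup>2"
      using p by (intro tendsto_intros)
    show "(\<lambda>k. D + inverse (real (Suc k))) \<longlonglongrightarrow> D"
      using tendsto_add[OF tendsto_const LIMSEQ_inverse_real_of_nat, of D] by simp
    show "\<exists>N. \<forall>n\<ge>N. (norm (x - y n))\<^sup>2 \<le> D + inverse (real (Suc n))"
      using y less_imp_le by blast
  qed
  have "inner s (x - p) = 0" if s: "s \<in> S" for s
  proof -
    have "0 \<le> 2 * t * (- inner s (x - p)) + t\<^sup>2 * (inner s s)" for t
    proof -
      have "(norm (x - p))\<^sup>2 \<le> (norm (x - (p + t *\<^sub>R s)))\<^sup>2"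
        using \<open>(norm (x - p))\<^sup>2 \<le> D\<close> D_le[of "p + t *\<^sub>R s"] S pS s
        by (meson order_trans subspace_add subspace_scale)
      then show ?thesis
        unfolding power2_norm_eq_inner
        by (simp add: algebra_simps inner_commute power2_eq_square)
    qed
    from inner_nonneg_quadratic_imp_zero[OF this] show ?thesis by simp
  qed
  then show ?thesis using pS by (auto simp: orthogonal_comp_iff)
qed

lemma orthogonal_decomposition_unique:
  fixes S :: "'b::real_inner set"
  assumes S: "subspace S" and "y \<in> S" "x - y \<in> S\<^sup>\<bottom>" "z \<in> S" "x - z \<in> S\<^sup>\<bottom>"
  shows "y = z"
proof -
  have "y - z \<in> S" using assms by (simp add: subspace_diff)
  then have "inner (y - z) (x - z) = 0" "inner (y - z) (x - y) = 0"
    using assms by (auto simp: orthogonal_comp_iff)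
  then have "inner (y - z) (y - z) = 0" by (simp add: algebra_simps)
  then show ?thesis by simp
qed

lemma orth_proj_eqI:
  fixes S :: "'b::real_inner set"
  assumes "subspace S" "y \<in> S" "x - y \<in> S\<^sup>\<bottom>"
  shows "orth_proj S x = y"
  unfolding orth_proj_def
  using assms orthogonal_decomposition_unique[OF assms(1)] by (intro the_equality) auto

lemma
  fixes S :: "'b::{real_inner,complete_space} set"
  assumes "subspace S" "closed S"
  shows orth_proj_mem: "orth_proj S x \<in> S"
    and orth_proj_residual: "x - orth_proj S x \<in> S\<^sup>\<bottom>"
  using orthogonal_decomposition_exists[OF assms, of x] orth_proj_eqI[OF assms(1)] by auto

lemma tendsto_orth_proj:
  fixes S :: "'b::{real_inner,complete_space} set"
  assumes S: "subspace S" "closed S" and f: "(f \<longlongrightarrow> a) F"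
  shows "((\<lambda>k. orth_proj S (f k)) \<longlongrightarrow> orth_proj S a) F"
proof -
  have le: "norm (orth_proj S x - orth_proj S y) \<le> norm (x - y)" for x y
  proof -
    let ?d = "orth_proj S x - orth_proj S y"
    have "?d \<in> S" using S by (simp add: subspace_diff orth_proj_mem)
    then have "inner ?d (x - orth_proj S x) = 0" "inner ?d (y - orth_proj S y) = 0"
      using orth_proj_residual[OF S] by (auto simp: orthogonal_comp_iff)
    then have "inner ?d (x - y) = (norm ?d)\<^sup>2"
      unfolding power2_norm_eq_inner by (simp add: algebra_simps)
    moreover have "inner ?d (x - y) \<le> norm ?d * norm (x - y)" by (rule norm_cauchy_schwarz)
    ultimately have "norm ?d * norm ?d \<le> norm ?d * norm (x - y)"
      by (simp add: power2_eq_square)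
    then show ?thesis
      by (cases "norm ?d = 0") (auto simp: mult_le_cancel_left)
  qed
  show ?thesis
    using f by (rule metric_tendsto_imp_tendsto) (simp add: dist_norm le)
qed

text \<open>
  The step size disappears: \<open>S\<^sup>\<bottom>\<close> is a subspace, so scaling the normal cone does not
  change it.
\<close>

lemma resolvent_normal_cone:
  fixes S :: "'b::{real_inner,complete_space} set"
  assumes S: "subspace S" "closed S" and c: "0 < c"
  shows "resolvent (op_scale c (normal_cone S)) z = orth_proj S z"
proof -
  have sc: "(\<lambda>u. c *\<^sub>R u) ` (S\<^sup>\<bottom>) = S\<^sup>\<bottom>"
  proof safe
    fix u assume "u \<in> S\<^sup>\<bottom>"
    then show "c *\<^sub>R u \<in> S\<^sup>\<bottom>" by (simp add: subspace_orthogonal_comp subspace_scale)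
  next
    fix u assume "u \<in> S\<^sup>\<bottom>"
    then have "(1 / c) *\<^sub>R u \<in> S\<^sup>\<bottom>" by (simp add: subspace_orthogonal_comp subspace_scale)
    moreover have "u = c *\<^sub>R ((1 / c) *\<^sub>R u)" using c by simp
    ultimately show "u \<in> (\<lambda>u. c *\<^sub>R u) ` (S\<^sup>\<bottom>)" by blast
  qed
  have "op_inverse (\<lambda>x. {x + u |u. u \<in> op_scale c (normal_cone S) x}) z
      = {x. x \<in> S \<and> z - x \<in> S\<^sup>\<bottom>}"
    unfolding op_inverse_def op_scale_def normal_cone_def
    by (auto simp: sc) (metis add_diff_cancel_left' diff_add_cancel add.commute)+
  also have "\<dots> = {orth_proj S z}"
    using S orth_proj_eqI[OF S(1)] by (auto simp: orth_proj_mem orth_proj_residual)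
  finally show ?thesis by (simp add: resolvent_def)
qed

section \<open>Relaxed iterations of a firmly nonexpansive linear operator\<close>

lemma subspace_closure:
  fixes S :: "'b::real_normed_vector set"
  assumes S: "subspace S"
  shows "subspace (closure S)"
proof (rule subspaceI)
  show "0 \<in> closure S" using S closure_subset subspace_0 by blast
next
  fix x y assume "x \<in> closure S" "y \<in> closure S"
  then obtain f g where "\<And>n. f n \<in> S" "f \<longlonglongrightarrow> x" "\<And>n. g n \<in> S" "g \<longlonglongrightarrow> y"
    unfolding closure_sequential by blast
  then show "x + y \<in> closure S"
    using S unfolding closure_sequential
    by (intro exI[of _ "\<lambda>n. f n + g n"]) (auto intro: subspace_add tendsto_add)
next
  fix c :: real and x assume "x \<in> closure S"
  then obtain f where "\<And>n. f n \<in> S" "f \<longlonglongrightarrow> x" unfolding closure_sequential by blast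
  then show "c *\<^sub>R x \<in> closure S"
    using S unfolding closure_sequential
    by (intro exI[of _ "\<lambda>n. c *\<^sub>R f n"]) (auto intro: subspace_scale tendsto_scaleR)
qed

text \<open>
  Let \<open>T = Id - \<theta> R\<close>.  Firm nonexpansiveness gives
  \<open>\<parallel>T w\<parallel>\<^sup>2 + \<theta> (2 - \<theta>) \<parallel>R w\<parallel>\<^sup>2 \<le> \<parallel>w\<parallel>\<^sup>2\<close>, hence \<open>R\<close> vanishes asymptotically along
  every orbit.  Since \<open>T\<close> and \<open>R\<close> commute, orbits starting in the range of \<open>R\<close> tend to \<open>0\<close>,
  and so do those starting in its closure, because all powers of \<open>T\<close> are nonexpansive.  That
  closure contains everything orthogonal to the kernel of \<open>R\<close>, in particular \<open>v 0 - p\<close>.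
\<close>

lemma relaxed_linear_iteration_tendsto:
  fixes R :: "'b::{real_inner,complete_space} \<Rightarrow> 'b"
  assumes lin: "linear R" and firm: "\<And>w. (norm (R w))\<^sup>2 \<le> inner (R w) w"
    and \<theta>: "0 < \<theta>" "\<theta> < 2"
    and v: "\<And>k. v (Suc k) = v k - \<theta> *\<^sub>R R (v k)"
    and p: "R p = 0" and orth: "\<And>z. R z = 0 \<Longrightarrow> inner (v 0 - p) z = 0"
  shows "v \<longlonglongrightarrow> p"
proof -
  define T where "T w = w - \<theta> *\<^sub>R R w" for w
  have linT: "linear T"
    unfolding T_def using lin by (intro linear_compose_sub linear_compose_scale_right linear_id[unfolded id_def])
  have linTk: "linear (T ^^ k)" for k
    by (induction k) (simp_all add: linear_ident linear_compose[OF _ linT, unfolded o_def] id_def o_def)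
  have decrease: "(norm (T w))\<^sup>2 + \<theta> * (2 - \<theta>) * (norm (R w))\<^sup>2 \<le> (norm w)\<^sup>2" for w
  proof -
    have "(norm (T w))\<^sup>2 = (norm w)\<^sup>2 - 2 * \<theta> * inner (R w) w + \<theta>\<^sup>2 * (norm (R w))\<^sup>2"
      unfolding T_def power2_norm_eq_inner
      by (simp add: algebra_simps inner_commute power2_eq_square)
    moreover have "\<theta> * (norm (R w))\<^sup>2 \<le> \<theta> * inner (R w) w"
      using firm \<theta> by (intro mult_left_mono) auto
    ultimately show ?thesis by (simp add: algebra_simps power2_eq_square)
  qed
  have nonexp: "norm (T w) \<le> norm w" for w
  proof -
    have "0 \<le> \<theta> * (2 - \<theta>) * (norm (R w))\<^sup>2" using \<theta> by simp
    then have "(norm (T w))\<^sup>2 \<le> (norm w)\<^sup>2" using decrease[of w] by linarith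
    then show ?thesis by (rule power2_le_imp_le) simp
  qed
  have nonexpk: "norm ((T ^^ k) w) \<le> norm w" for k w
    by (induction k) (auto intro: order_trans[OF nonexp])
  have residual: "(\<lambda>k. R ((T ^^ k) w)) \<longlonglongrightarrow> 0" for w
  proof -
    let ?c = "\<theta> * (2 - \<theta>)"
    have c: "?c > 0" using \<theta> by simp
    have "(\<Sum>k<n. ?c * (norm (R ((T ^^ k) w)))\<^sup>2) \<le> (norm w)\<^sup>2 - (norm ((T ^^ n) w))\<^sup>2" for n
    proof (induction n)
      case (Suc n)
      then show ?case using decrease[of "(T ^^ n) w"] by simp
    qed simp
    then have "(\<Sum>k<n. ?c * (norm (R ((T ^^ k) w)))\<^sup>2) \<le> (norm w)\<^sup>2" for n
      by (rule order_trans) simp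
    then have "(\<Sum>k\<le>n. ?c * (norm (R ((T ^^ k) w)))\<^sup>2) \<le> (norm w)\<^sup>2" for n
      by (simp only: lessThan_Suc_atMost[symmetric])
    then have "summable (\<lambda>k. ?c * (norm (R ((T ^^ k) w)))\<^sup>2)"
      using c by (intro bounded_imp_summable[of _ "(norm w)\<^sup>2"]) auto
    then have "(\<lambda>k. ?c * (norm (R ((T ^^ k) w)))\<^sup>2) \<longlonglongrightarrow> 0" by (rule summable_LIMSEQ_zero)
    then have "(\<lambda>k. inverse ?c * (?c * (norm (R ((T ^^ k) w)))\<^sup>2)) \<longlonglongrightarrow> 0"
      by (rule tendsto_mult_right_zero)
    then have "(\<lambda>k. (norm (R ((T ^^ k) w)))\<^sup>2) \<longlonglongrightarrow> 0" using \<theta> by simp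
    from tendsto_real_sqrt[OF this] show ?thesis
      by (simp add: tendsto_norm_zero_iff)
  qed
  have commute: "(T ^^ k) (R w) = R ((T ^^ k) w)" for k w
    by (induction k) (auto simp: T_def linear_diff[OF lin] linear_scale[OF lin])
  define q where "q = v 0 - p"
  define M where "M = closure (range R)"
  have "subspace (range R)" using lin by (simp add: linear_subspace_image subspace_UNIV)
  then have M: "subspace M" "closed M" by (auto simp: M_def subspace_closure)
  \<comment> \<open>A vector \<open>r\<close> orthogonal to the range satisfies \<open>\<parallel>R r\<parallel>\<^sup>2 \<le> \<langle>R r, r\<rangle> = 0\<close>, so it lies in the kernel.\<close>
  have qM: "q \<in> M"
  proof -
    obtain m where m: "m \<in> M" "q - m \<in> M\<^sup>\<bottom>"
      using orthogonal_decomposition_exists[OF M] by blast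
    have "R (q - m) \<in> M" by (simp add: M_def closure_subset[THEN subsetD])
    then have "inner (R (q - m)) (q - m) = 0"
      using m(2) by (auto simp: orthogonal_comp_iff)
    then have "R (q - m) = 0" using firm[of "q - m"] by simp
    then have "inner q (q - m) = 0" using orth by (simp add: q_def)
    moreover have "inner m (q - m) = 0" using m by (auto simp: orthogonal_comp_iff)
    ultimately have "inner (q - m) (q - m) = 0" by (simp add: inner_diff_left)
    then show ?thesis using m by simp
  qed
  have "(\<lambda>k. (T ^^ k) q) \<longlonglongrightarrow> 0"
  proof (rule LIMSEQ_I)
    fix e :: real assume e: "0 < e"
    obtain w where w: "norm (R w - q) < e / 2"
      using qM e unfolding M_def closure_approachable by (force simp: dist_norm dest: spec[of _ "e/2"])
    obtain N where N: "\<And>k. k \<ge> N \<Longrightarrow> norm (R ((T ^^ k) w)) < e / 2"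
      using LIMSEQ_D[OF residual[of w], of "e/2"] e by auto
    have "norm ((T ^^ k) q) < e" if "k \<ge> N" for k
    proof -
      have "(T ^^ k) q = (T ^^ k) (R w) - (T ^^ k) (R w - q)"
        by (simp add: linear_diff[OF linTk])
      then have "norm ((T ^^ k) q) \<le> norm ((T ^^ k) (R w)) + norm ((T ^^ k) (R w - q))"
        by (metis norm_triangle_ineq4)
      also have "\<dots> < e / 2 + e / 2"
        using N[OF that] nonexpk[of k "R w - q"] w by (intro add_strict_mono) (auto simp: commute)
      finally show ?thesis by simp
    qed
    then show "\<exists>N. \<forall>k\<ge>N. norm ((T ^^ k) q - 0) < e" by auto
  qed
  then have "(\<lambda>k. p + (T ^^ k) q) \<longlonglongrightarrow> p + 0"
    by (intro tendsto_add tendsto_const)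
  moreover have "v k = p + (T ^^ k) q" for k
  proof (induction k)
    case (Suc k)
    then show ?case
      by (simp add: v T_def p linear_add[OF lin])
  qed (simp add: q_def)
  then have "v = (\<lambda>k. p + (T ^^ k) q)" by blast
  ultimately show ?thesis by simp
qed

section \<open>Matrices acting on products of a Hilbert space\<close>

lemma lift_mat_nth: "lift_mat K x $ i = (\<Sum>j\<in>UNIV. K $ i $ j *\<^sub>R x $ j)"
  by (simp add: lift_mat_def)

lemma linear_lift_mat: "linear (lift_mat K)"
  by (rule linearI)
    (simp_all add: vec_eq_iff lift_mat_nth scaleR_add_right sum.distrib scaleR_sum_right mult.commute)

lemma lift_mat_one: "lift_mat (mat 1) x = x"
  by (simp add: vec_eq_iff lift_mat_nth mat_def if_distrib[of "\<lambda>c. c *\<^sub>R _"] cong: if_cong)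

lemma lift_mat_diff_matrix: "lift_mat (A - B) x = lift_mat A x - lift_mat B x"
  by (simp add: vec_eq_iff lift_mat_nth scaleR_diff_left sum_subtractf)

lemma lift_mat_mult: "lift_mat A (lift_mat B x) = lift_mat (A ** B) x"
proof -
  have "(\<Sum>j\<in>UNIV. \<Sum>k\<in>UNIV. (A $ i $ j * B $ j $ k) *\<^sub>R x $ k)
      = (\<Sum>k\<in>UNIV. \<Sum>j\<in>UNIV. (A $ i $ j * B $ j $ k) *\<^sub>R x $ k)" for i
    by (rule sum.swap)
  then show ?thesis
    by (simp add: vec_eq_iff lift_mat_nth matrix_matrix_mult_def scaleR_sum_right scaleR_sum_left)
qed

lemma lift_mat_real: "lift_mat K (y :: real ^ 'p) = K *v y"
  by (simp add: vec_eq_iff lift_mat_nth matrix_vector_mult_def)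

lemma inner_lift_mat_transpose:
  fixes x :: "'a::real_inner ^ 'm"
  shows "inner (lift_mat (transpose K) x) y = inner x (lift_mat K y)"
proof -
  have "(\<Sum>j\<in>UNIV. \<Sum>i\<in>UNIV. K $ i $ j * inner (x $ i) (y $ j))
      = (\<Sum>i\<in>UNIV. \<Sum>j\<in>UNIV. K $ i $ j * inner (x $ i) (y $ j))"
    by (rule sum.swap)
  then show ?thesis
    by (simp add: inner_vec_def lift_mat_nth transpose_def inner_sum_left inner_sum_right)
qed

text \<open>
  The elementary tensor \<open>\<beta> \<otimes> u\<close>; it is the adjoint of \<open>lift_adj \<beta>\<close> applied to \<open>u\<close>.
\<close>

definition tensor_vec :: "real ^ 'm \<Rightarrow> 'a::real_vector \<Rightarrow> 'a ^ 'm" where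
  "tensor_vec \<beta> u = (\<chi> i. \<beta> $ i *\<^sub>R u)"

lemma lift_mat_tensor_vec: "lift_mat K (tensor_vec \<beta> u) = tensor_vec (K *v \<beta>) u"
  by (simp add: vec_eq_iff lift_mat_nth tensor_vec_def matrix_vector_mult_def scaleR_sum_left)

lemma inner_tensor_vec: "inner v (tensor_vec \<beta> u) = inner (lift_adj \<beta> v) u"
  by (simp add: inner_vec_def tensor_vec_def lift_adj_def inner_sum_left)

lemma lift_adj_tensor_vec: "lift_adj \<beta> (tensor_vec \<beta> u) = (norm \<beta>)\<^sup>2 *\<^sub>R u"
  by (simp add: lift_adj_def tensor_vec_def scaleR_sum_left[symmetric] power2_norm_eq_inner inner_vec_def)

lemma product_space_orthogonal_comp:
  fixes U :: "'n::finite \<Rightarrow> 'a::real_inner set"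
  assumes "\<And>i. 0 \<in> U i"
  shows "w \<in> (product_space U)\<^sup>\<bottom> \<longleftrightarrow> (\<forall>i. w $ i \<in> (U i)\<^sup>\<bottom>)"
proof
  assume w: "w \<in> (product_space U)\<^sup>\<bottom>"
  show "\<forall>i. w $ i \<in> (U i)\<^sup>\<bottom>"
  proof (intro allI)
    fix i
    have "inner s (w $ i) = 0" if "s \<in> U i" for s
    proof -
      have "axis i s \<in> product_space U"
        using that assms by (auto simp: product_space_def axis_def)
      then have "inner (axis i s) w = 0" using w by (auto simp: orthogonal_comp_def orthogonal_def)
      then show ?thesis
        by (simp add: inner_vec_def axis_def if_distrib[of "\<lambda>a. inner a _"] cong: if_cong)
    qed
    then show "w $ i \<in> (U i)\<^sup>\<bottom>" by (auto simp: orthogonal_comp_def orthogonal_def)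
  qed
next
  assume "\<forall>i. w $ i \<in> (U i)\<^sup>\<bottom>"
  then show "w \<in> (product_space U)\<^sup>\<bottom>"
    by (auto simp: orthogonal_comp_def orthogonal_def product_space_def inner_vec_def)
qed

lemma diagonal_space_orthogonal_comp:
  fixes w :: "'a::real_inner ^ 'n"
  shows "w \<in> diagonal_space\<^sup>\<bottom> \<longleftrightarrow> (\<Sum>i\<in>UNIV. w $ i) = 0"
proof -
  have "w \<in> diagonal_space\<^sup>\<bottom> \<longleftrightarrow> (\<forall>u. inner u (\<Sum>i\<in>UNIV. w $ i) = 0)"
    by (simp add: orthogonal_comp_def orthogonal_def diagonal_space_def inner_vec_def inner_sum_right)
  also have "\<dots> \<longleftrightarrow> (\<Sum>i\<in>UNIV. w $ i) = 0"
    by (metis inner_eq_zero_iff inner_zero_right)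
  finally show ?thesis .
qed

section \<open>The Moore--Penrose inverse\<close>

text \<open>
  The symmetry conditions identify \<open>Z ** X\<close> with \<open>Z ** Y\<close> and \<open>X ** Z\<close> with \<open>Y ** Z\<close>;
  both inverses are then recovered from these two common products.
\<close>

lemma moore_penrose_unique:
  assumes X: "is_moore_penrose Z X" and Y: "is_moore_penrose Z Y"
  shows "X = Y"
proof -
  note X = X[unfolded is_moore_penrose_def] and Y = Y[unfolded is_moore_penrose_def]
  have "Z ** X = transpose (Z ** Y ** Z ** X)" using X Y by simp
  also have "\<dots> = transpose (Z ** X) ** transpose (Z ** Y)"
    by (simp add: matrix_transpose_mul[symmetric] matrix_mul_assoc)
  also have "\<dots> = Z ** X ** Z ** Y" using X Y by (simp add: matrix_mul_assoc)
  finally have ZX: "Z ** X = Z ** Y" using X by simp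
  have "X ** Z = transpose (X ** (Z ** Y ** Z))" using X Y by simp
  also have "\<dots> = transpose (Y ** Z) ** transpose (X ** Z)"
    by (simp add: matrix_transpose_mul[symmetric] matrix_mul_assoc)
  also have "\<dots> = (Y ** Z) ** (X ** Z)" using X Y by simp
  also have "\<dots> = Y ** (Z ** X ** Z)" by (simp only: matrix_mul_assoc)
  finally have XZ: "X ** Z = Y ** Z" using X by simp
  have "X = X ** Z ** X" using X by simp
  also have "\<dots> = Y ** (Z ** X)" by (simp add: XZ matrix_mul_assoc)
  also have "\<dots> = Y" using Y by (simp add: ZX matrix_mul_assoc)
  finally show ?thesis .
qed

lemma moore_penrose_eqI: "is_moore_penrose Z X \<Longrightarrow> moore_penrose Z = X"
  unfolding moore_penrose_def using moore_penrose_unique by blast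

text \<open>
  For injective \<open>Z\<close> the Gram matrix is invertible, and the Moore--Penrose inverse is the
  least-squares solution operator \<open>(Z\<^sup>T Z)\<inverse> Z\<^sup>T\<close>.  Hence it is a left inverse, and
  \<open>Z ** moore_penrose Z\<close> is an orthogonal projection.
\<close>

lemma moore_penrose_injective:
  fixes Z :: "real ^ 'm ^ 'n"
  assumes inj: "inj ((*v) Z)"
  shows "moore_penrose Z ** Z = mat 1"
    and "transpose (Z ** moore_penrose Z) = Z ** moore_penrose Z"
proof -
  define G where "G = transpose Z ** Z"
  have "y = 0" if "G *v y = 0" for y
  proof -
    have "inner (Z *v y) (Z *v y) = inner y (G *v y)"
      using dot_lmul_matrix[of "Z *v y" Z y]
      by (simp add: G_def matrix_vector_mul_assoc[symmetric] inner_commute)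
    then have "Z *v y = Z *v 0" using that by simp
    then show ?thesis using inj by (simp add: inj_def)
  qed
  then obtain B where B: "B ** G = mat 1"
    using matrix_left_invertible_ker[of G] by blast
  then have B': "G ** B = mat 1" by (simp add: matrix_left_right_inverse)
  have "transpose B = B ** (G ** transpose B)" by (simp add: B matrix_mul_assoc)
  also have "G ** transpose B = transpose (B ** G)"
    unfolding G_def matrix_transpose_mul by simp
  finally have Bt: "transpose B = B" by (simp add: B transpose_mat)
  let ?X = "B ** transpose Z"
  have XZ: "?X ** Z = mat 1" using B by (simp add: G_def matrix_mul_assoc)
  moreover have sym: "transpose (Z ** ?X) = Z ** ?X"
    by (simp add: matrix_transpose_mul Bt matrix_mul_assoc)
  moreover have "Z ** ?X ** Z = Z" using XZ by (metis matrix_mul_assoc matrix_mul_rid)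
  ultimately have "is_moore_penrose Z ?X"
    by (simp add: is_moore_penrose_def transpose_mat)
  then have "moore_penrose Z = ?X" by (rule moore_penrose_eqI)
  then show "moore_penrose Z ** Z = mat 1"
    and "transpose (Z ** moore_penrose Z) = Z ** moore_penrose Z"
    using XZ sym by simp_all
qed

section \<open>Energy and degrees of a graph\<close>

lemma
  fixes \<E> :: "('n::finite \<times> 'n) set"
  shows sum_edges_out: "(\<Sum>(i, j)\<in>\<E>. f i j) = (\<Sum>i\<in>UNIV. \<Sum>j | (i, j) \<in> \<E>. f i j)"
    and sum_edges_in: "(\<Sum>(i, j)\<in>\<E>. f i j) = (\<Sum>j\<in>UNIV. \<Sum>i | (i, j) \<in> \<E>. f i j)"
proof -
  have 1: "\<E> = Sigma UNIV (\<lambda>i. {j. (i, j) \<in> \<E>})" by auto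
  show "(\<Sum>(i, j)\<in>\<E>. f i j) = (\<Sum>i\<in>UNIV. \<Sum>j | (i, j) \<in> \<E>. f i j)"
    by (subst sum.Sigma) (use 1 in auto)
  have 2: "prod.swap ` \<E> = Sigma UNIV (\<lambda>j. {i. (i, j) \<in> \<E>})" by force
  have "(\<Sum>(i, j)\<in>\<E>. f i j) = (\<Sum>(j, i)\<in>prod.swap ` \<E>. f i j)"
    by (subst sum.reindex) (auto simp: case_prod_unfold)
  then show "(\<Sum>(i, j)\<in>\<E>. f i j) = (\<Sum>j\<in>UNIV. \<Sum>i | (i, j) \<in> \<E>. f i j)"
    by (subst sum.Sigma) (use 2 in auto)
qed

text \<open>
  The Dirichlet energy of the graph.  It is the quantity in which the resolvents (through the
  larger graph) and the update of \<open>v\<close> (through the Laplacian of the smaller one) are compared.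
\<close>

definition edge_energy :: "('n \<times> 'n) set \<Rightarrow> 'a::real_inner ^ 'n \<Rightarrow> real" where
  "edge_energy \<E> y = (\<Sum>(i, j)\<in>\<E>. (norm (y $ i - y $ j))\<^sup>2)"

lemma edge_energy_mono:
  fixes \<E> :: "('n::finite \<times> 'n) set"
  assumes "\<E>' \<subseteq> \<E>"
  shows "edge_energy \<E>' y \<le> edge_energy \<E> y"
  unfolding edge_energy_def using assms by (intro sum_mono2) auto

lemma edge_energy_eq:
  fixes \<E> :: "('n::finite \<times> 'n) set"
  shows "edge_energy \<E> y
    = (\<Sum>i\<in>UNIV. real (deg \<E> i) * (norm (y $ i))\<^sup>2)
      - 2 * (\<Sum>(i, j)\<in>\<E>. inner (y $ i) (y $ j))"
proof -
  have "edge_energy \<E> y = (\<Sum>(i, j)\<in>\<E>. (norm (y $ i))\<^sup>2 + (norm (y $ j))\<^sup>2 - 2 * inner (y $ i) (y $ j))"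
    unfolding edge_energy_def power2_norm_eq_inner
    by (intro sum.cong) (auto simp: algebra_simps inner_commute)
  also have "\<dots> = (\<Sum>(i, j)\<in>\<E>. (norm (y $ i))\<^sup>2) + (\<Sum>(i, j)\<in>\<E>. (norm (y $ j))\<^sup>2)
       - 2 * (\<Sum>(i, j)\<in>\<E>. inner (y $ i) (y $ j))"
    by (simp add: case_prod_unfold sum.distrib sum_subtractf sum_distrib_left)
  also have "(\<Sum>(i, j)\<in>\<E>. (norm (y $ i))\<^sup>2) = (\<Sum>i\<in>UNIV. real (out_deg \<E> i) * (norm (y $ i))\<^sup>2)"
    by (subst sum_edges_out) (simp add: out_deg_def)
  also have "(\<Sum>(i, j)\<in>\<E>. (norm (y $ j))\<^sup>2) = (\<Sum>i\<in>UNIV. real (in_deg \<E> i) * (norm (y $ i))\<^sup>2)"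
    by (subst sum_edges_in) (simp add: in_deg_def)
  finally show ?thesis by (simp add: deg_def algebra_simps sum.distrib)
qed

lemma inner_Lap:
  fixes \<E> :: "('n::{finite,linorder} \<times> 'n) set"
    and y :: "'a::real_inner ^ 'n::{finite,linorder}"
  assumes less: "\<And>i j. (i, j) \<in> \<E> \<Longrightarrow> i < j"
  shows "inner y (lift_mat (Lap \<E>) y) = edge_energy \<E> y"
proof -
  have entry: "Lap \<E> $ i $ j = (if i = j then real (deg \<E> i) else 0)
      - (if (i, j) \<in> \<E> then 1 else 0) - (if (j, i) \<in> \<E> then 1 else 0)" for i j
    using less[of i j] less[of j i] by (auto simp: Lap_def)
  have "lift_mat (Lap \<E>) y $ i = real (deg \<E> i) *\<^sub>R y $ i
      - (\<Sum>j | (i, j) \<in> \<E>. y $ j) - (\<Sum>j | (j, i) \<in> \<E>. y $ j)" for i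
    unfolding lift_mat_nth entry
    by (simp add: scaleR_diff_left sum_subtractf sum.inter_filter[symmetric]
          if_distrib[of "\<lambda>c. c *\<^sub>R _"] cong: if_cong)
  then have "inner y (lift_mat (Lap \<E>) y) = (\<Sum>i\<in>UNIV. real (deg \<E> i) * (norm (y $ i))\<^sup>2)
      - (\<Sum>i\<in>UNIV. \<Sum>j | (i, j) \<in> \<E>. inner (y $ i) (y $ j))
      - (\<Sum>i\<in>UNIV. \<Sum>j | (j, i) \<in> \<E>. inner (y $ j) (y $ i))"
    by (simp add: inner_vec_def inner_diff_right inner_sum_right sum_subtractf power2_norm_eq_inner inner_commute)
  then show ?thesis
    by (simp add: edge_energy_eq sum_edges_out[symmetric] sum_edges_in[symmetric])
qed

lemma edge_energy_zero_imp_constant: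
  fixes \<E> :: "('n::finite \<times> 'n) set"
  assumes conn: "connected_graph \<E>" and 0: "edge_energy \<E> y = 0"
  shows "y $ i = y $ j"
proof -
  have edge: "y $ a = y $ b" if "(a, b) \<in> \<E>" for a b
  proof -
    have "\<forall>p\<in>\<E>. (case p of (i, j) \<Rightarrow> (norm (y $ i - y $ j))\<^sup>2) = 0"
      using 0 unfolding edge_energy_def by (subst (asm) sum_nonneg_eq_0_iff) auto
    then show ?thesis using that by auto
  qed
  have "(i, j) \<in> (\<E> \<union> \<E>\<inverse>)\<^sup>*" using conn by (simp add: connected_graph_def)
  then show ?thesis
    by (induction rule: rtrancl_induct) (use edge in fastforce)+
qed

lemma deg_pos:
  assumes "algorithmic_graph \<E>"
  shows "0 < deg \<E> i"
proof -
  have "1 < card (UNIV :: 'a set)" using assms by (simp add: algorithmic_graph_def)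
  then obtain j where j: "j \<noteq> i"
    by (metis card_1_singleton_iff UNIV_eq_I insertI1 less_irrefl One_nat_def)
  have "(i, j) \<in> (\<E> \<union> \<E>\<inverse>)\<^sup>*"
    using assms by (simp add: algorithmic_graph_def connected_graph_def)
  then obtain h where "(i, h) \<in> \<E> \<union> \<E>\<inverse>"
    using j by (metis converse_rtranclE)
  then have "{j. (i, j) \<in> \<E>} \<noteq> {} \<or> {j. (j, i) \<in> \<E>} \<noteq> {}" by auto
  then show ?thesis by (auto simp: deg_def in_deg_def out_deg_def card_gt_0_iff)
qed

text \<open>
  The smallest vertex has no incoming edge, but it has some edge.
\<close>

lemma degree_balance_nonzero:
  assumes "algorithmic_graph \<E>"
  shows "degree_balance \<E> \<noteq> 0"
proof -
  define i where "i = Min (UNIV :: 'a set)"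
  have "i \<le> j" for j unfolding i_def by (rule Min_le) auto
  then have "\<not> j < i" for j by (simp add: not_less)
  then have "in_deg \<E> i = 0" using assms by (auto simp: in_deg_def algorithmic_graph_def)
  then have "degree_balance \<E> $ i > 0"
    using deg_pos[OF assms, of i] by (simp add: degree_balance_def deg_def)
  then show ?thesis by auto
qed

lemma sum_degree_balance:
  fixes \<E> :: "('n::finite \<times> 'n) set"
  shows "(\<Sum>i\<in>UNIV. degree_balance \<E> $ i) = 0"
  using sum_edges_out[of "\<lambda>_ _. 1::real" \<E>] sum_edges_in[of "\<lambda>_ _. 1::real" \<E>]
  by (simp add: degree_balance_def out_deg_def in_deg_def sum_subtractf)

section \<open>Factorizations of a graph Laplacian\<close>

locale graph_factorization =
  fixes \<E> \<E>' :: "('n::{finite,linorder} \<times> 'n) set"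
    and Z :: "real ^ 'm::finite ^ 'n::{finite,linorder}"
  assumes card_columns: "CARD('m) = CARD('n) - 1"
    and algorithmic: "algorithmic_graph \<E>"
    and subgraph: "\<E>' \<subseteq> \<E>"
    and connected: "connected_graph \<E>'"
    and Lap_eq: "Lap \<E>' = Z ** transpose Z"
begin

lemma edge_less: "(i, j) \<in> \<E> \<Longrightarrow> i < j"
  using algorithmic by (simp add: algorithmic_graph_def)

lemma norm_transpose_eq_edge_energy:
  fixes y :: "'a::real_inner ^ 'n::{finite,linorder}"
  shows "(norm (lift_mat (transpose Z) y))\<^sup>2 = edge_energy \<E>' y"
proof -
  have "(norm (lift_mat (transpose Z) y))\<^sup>2 = inner y (lift_mat (Lap \<E>') y)"
    by (simp add: power2_norm_eq_inner inner_lift_mat_transpose lift_mat_mult Lap_eq)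
  also have "\<dots> = edge_energy \<E>' y"
    using edge_less subgraph by (intro inner_Lap) auto
  finally show ?thesis .
qed

lemma lift_transpose_zero_iff:
  fixes y :: "'a::real_inner ^ 'n::{finite,linorder}"
  shows "lift_mat (transpose Z) y = 0 \<longleftrightarrow> (\<forall>i j. y $ i = y $ j)"
proof
  assume "lift_mat (transpose Z) y = 0"
  then have "edge_energy \<E>' y = 0" using norm_transpose_eq_edge_energy[of y] by simp
  then show "\<forall>i j. y $ i = y $ j" using edge_energy_zero_imp_constant[OF connected] by blast
next
  assume "\<forall>i j. y $ i = y $ j"
  then have "edge_energy \<E>' y = 0"
    unfolding edge_energy_def by (intro sum.neutral) (auto simp: dist_norm[symmetric])
  then show "lift_mat (transpose Z) y = 0" using norm_transpose_eq_edge_energy[of y] by simp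
qed

lemma sum_lift_mat: "(\<Sum>i\<in>UNIV. lift_mat Z w $ i) = 0" for w :: "'a::real_inner ^ 'm"
proof -
  have "inner (\<chi> i. u) (lift_mat Z w) = 0" for u :: 'a
    using lift_transpose_zero_iff[of "\<chi> i. u"] by (simp add: inner_lift_mat_transpose[symmetric])
  then have "inner u (\<Sum>i\<in>UNIV. lift_mat Z w $ i) = 0" for u
    by (simp add: inner_vec_def inner_sum_right)
  then show ?thesis using inner_eq_zero_iff by blast
qed

text \<open>
  The kernel of \<open>transpose Z\<close> is the line of constant vectors, so \<open>transpose Z\<close> is injective on
  the hyperplane of vectors with zero sum.  The number of columns is the dimension of this
  hyperplane, so \<open>transpose Z\<close> is onto, which makes \<open>Z\<close> injective.
\<close>

lemma inj_mult_Z: "inj ((*v) Z)"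
proof -
  define H where "H = {y :: real ^ 'n::{finite,linorder}. inner 1 y = 0}"
  have H: "subspace H" unfolding H_def by (rule subspace_hyperplane)
  have "(1 :: real ^ 'n::{finite,linorder}) \<noteq> 0" by (simp add: vec_eq_iff)
  then have "dim H = CARD('m)" by (simp add: H_def dim_hyperplane card_columns)
  moreover have "inj_on ((*v) (transpose Z)) (span H)"
  proof (rule inj_onI)
    fix y z assume yz: "y \<in> span H" "z \<in> span H" "transpose Z *v y = transpose Z *v z"
    then have yzH: "y - z \<in> H" using H by (metis span_eq_iff subspace_diff)
    have "lift_mat (transpose Z) (y - z) = 0"
      using yz by (simp add: lift_mat_real matrix_vector_mult_diff_distrib)
    then obtain c where c: "\<And>i. (y - z) $ i = c"
      unfolding lift_transpose_zero_iff by metis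
    then have "c * CARD('n) = 0" using yzH by (simp add: H_def inner_vec_def)
    then have "y - z = 0" using c by (simp add: vec_eq_iff)
    then show "y = z" by simp
  qed
  ultimately have "dim ((*v) (transpose Z) ` H) = CARD('m)"
    using dim_image_eq[OF matrix_vector_mul_linear] by metis
  then have "span ((*v) (transpose Z) ` H) = UNIV"
    by (subst dim_eq_full[symmetric]) (simp only: DIM_cart DIM_real mult_1_right)
  then have "(*v) (transpose Z) ` H = UNIV"
    by (metis H span_eq_iff linear_subspace_image matrix_vector_mul_linear)
  then have surj: "\<exists>y. c = transpose Z *v y" for c by (metis UNIV_I imageE)
  have "c = 0" if "Z *v c = 0" for c
  proof -
    obtain y where y: "c = transpose Z *v y" using surj by blast
    have "inner c c = inner (transpose Z *v y) c" using y by metis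
    also have "\<dots> = inner y (Z *v c)"
      using inner_lift_mat_transpose[of Z y c] unfolding lift_mat_real .
    finally show ?thesis using that by simp
  qed
  then show ?thesis
    by (simp add: inj_matrix_vector_mult matrix_left_invertible_ker matrix_left_invertible_injective[symmetric])
qed

lemma lift_mat_pinv_left: "lift_mat (moore_penrose Z) (lift_mat Z w) = w"
  by (simp add: lift_mat_mult moore_penrose_injective[OF inj_mult_Z] lift_mat_one)

text \<open>
  \<open>Q = 1 - Z ** moore_penrose Z\<close> is symmetric with \<open>transpose Z ** Q = 0\<close>, so all its columns
  are constant vectors; by symmetry \<open>Q\<close> is a multiple of the all-ones matrix and annihilates
  vectors with zero sum.
\<close>

lemma lift_mat_pinv_right:
  fixes w :: "'a::real_vector ^ 'n::{finite,linorder}"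
  assumes "(\<Sum>i\<in>UNIV. w $ i) = 0"
  shows "lift_mat Z (lift_mat (moore_penrose Z) w) = w"
proof -
  define Q where "Q = mat 1 - Z ** moore_penrose Z"
  have Qt: "transpose Q = Q"
    using moore_penrose_injective(2)[OF inj_mult_Z]
    by (simp add: Q_def vec_eq_iff transpose_def mat_def)
  have "Q ** Z = Z - Z ** (moore_penrose Z ** Z)"
    unfolding Q_def matrix_mul_assoc
    by (simp add: vec_eq_iff matrix_matrix_mult_def mat_def left_diff_distrib sum_subtractf
        if_distrib[of "\<lambda>c. c * _"] cong: if_cong)
  then have "Q ** Z = 0" by (simp add: moore_penrose_injective[OF inj_mult_Z])
  moreover have "transpose Z ** Q = transpose (Q ** Z)" by (simp only: matrix_transpose_mul Qt)
  ultimately have "transpose Z ** Q = 0" by (simp add: transpose_def vec_eq_iff)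
  then have "transpose Z *v column j Q = 0" for j
    by (simp add: vec_eq_iff matrix_matrix_mult_def matrix_vector_mult_def column_def)
  then have "column j Q $ i = column j Q $ i'" for i i' j
    using lift_transpose_zero_iff[of "column j Q"] by (simp add: lift_mat_real)
  then have const: "Q $ i $ j = Q $ i' $ j" for i i' j by (simp add: column_def)
  moreover have "Q $ i $ j = Q $ j $ i" for i j
    using Qt by (metis (no_types, lifting) transpose_def vec_lambda_beta)
  ultimately have "Q $ i $ j = Q $ i $ i" for i j by metis
  then have "lift_mat Q w $ i = Q $ i $ i *\<^sub>R (\<Sum>j\<in>UNIV. w $ j)" for i
    unfolding lift_mat_nth scaleR_sum_right by (metis (no_types, lifting))
  then have "lift_mat Q w = 0" using assms by (simp add: vec_eq_iff)
  then show ?thesis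
    by (simp add: Q_def lift_mat_diff_matrix lift_mat_one lift_mat_mult)
qed

definition balance_coeff :: "real ^ 'm" where
  "balance_coeff = moore_penrose Z *v degree_balance \<E>"

lemma mult_balance_coeff: "Z *v balance_coeff = degree_balance \<E>"
  using lift_mat_pinv_right[OF sum_degree_balance[of \<E>]] by (simp add: lift_mat_real balance_coeff_def)

lemma balance_coeff_nonzero: "balance_coeff \<noteq> 0"
  using degree_balance_nonzero[OF algorithmic] mult_balance_coeff by auto

end

section \<open>The linear dynamics of the algorithm\<close>

lemma wf_less_finite_linorder: "wf {(i, j). i < (j :: 'n::{finite,linorder})}"
proof (rule wf_subset)
  show "wf (Wellfounded.measure (\<lambda>i::'n. card {..<i}))" by simp
  show "{(i, j). i < j} \<subseteq> Wellfounded.measure (\<lambda>i::'n. card {..<i})"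
    by (auto intro!: psubset_card_mono)
qed

locale subspace_splitting = graph_factorization \<E> \<E>' Z
  for \<E> \<E>' :: "('n::{finite,linorder} \<times> 'n) set"
    and Z :: "real ^ 'm::finite ^ 'n::{finite,linorder}" +
  fixes U :: "'n::{finite,linorder} \<Rightarrow> 'a::{real_inner,complete_space} set"
  assumes subspace_U: "\<And>i. subspace (U i)" and closed_U: "\<And>i. closed (U i)"
begin

text \<open>
  \<open>sweep w y\<close> says that one pass through the resolvents turns \<open>w\<close> into \<open>y\<close>.  Written with
  orthogonality instead of projections, the relation is visibly a linear subspace of pairs,
  while \<open>sweep_iff_projection\<close> gives back the recursion along the vertices.
\<close>

definition sweep :: "'a ^ 'm \<Rightarrow> 'a ^ 'n::{finite,linorder} \<Rightarrow> bool" where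
  "sweep w y \<longleftrightarrow> (\<forall>i. y $ i \<in> U i \<and>
     2 *\<^sub>R (\<Sum>h | (h, i) \<in> \<E>. y $ h) + lift_mat Z w $ i - real (deg \<E> i) *\<^sub>R y $ i \<in> (U i)\<^sup>\<bottom>)"

lemma sweep_iff_projection:
  "sweep w y \<longleftrightarrow> (\<forall>i. y $ i = orth_proj (U i)
     ((2 / real (deg \<E> i)) *\<^sub>R (\<Sum>h | (h, i) \<in> \<E>. y $ h) + (1 / real (deg \<E> i)) *\<^sub>R lift_mat Z w $ i))"
  (is "_ \<longleftrightarrow> (\<forall>i. _ = orth_proj _ (?a i))")
proof -
  have "(2 *\<^sub>R (\<Sum>h | (h, i) \<in> \<E>. y $ h) + lift_mat Z w $ i - real (deg \<E> i) *\<^sub>R y $ i \<in> (U i)\<^sup>\<bottom>)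
      \<longleftrightarrow> ?a i - y $ i \<in> (U i)\<^sup>\<bottom>" (is "?b \<in> _ \<longleftrightarrow> _") for i
  proof -
    let ?d = "real (deg \<E> i)"
    have d: "?d > 0" using deg_pos[OF algorithmic] by simp
    have 1: "?b = ?d *\<^sub>R (?a i - y $ i)" "?a i - y $ i = (1 / ?d) *\<^sub>R ?b"
      using d by (simp_all add: algebra_simps)
    show ?thesis
      using subspace_scale[OF subspace_orthogonal_comp, of _ "U i"] 1 by metis
  qed
  then have "sweep w y \<longleftrightarrow> (\<forall>i. y $ i \<in> U i \<and> ?a i - y $ i \<in> (U i)\<^sup>\<bottom>)"
    by (simp add: sweep_def)
  also have "\<dots> \<longleftrightarrow> (\<forall>i. y $ i = orth_proj (U i) (?a i))"
    by (metis orth_proj_eqI orth_proj_mem orth_proj_residual subspace_U closed_U)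
  finally show ?thesis .
qed

text \<open>
  Edges point upwards, so each component depends only on components at smaller vertices.
\<close>

lemma sweep_exists: "\<exists>y. sweep w y"
proof -
  have "\<exists>f. \<forall>i. f i = orth_proj (U i)
     ((2 / real (deg \<E> i)) *\<^sub>R (\<Sum>h | (h, i) \<in> \<E>. f h) + (1 / real (deg \<E> i)) *\<^sub>R lift_mat Z w $ i)"
  proof (rule dependent_wf_choice[OF wf_less_finite_linorder])
    fix f g :: "'n \<Rightarrow> 'a" and i r
    assume "\<And>z. (z, i) \<in> {(i, j). i < j} \<Longrightarrow> f z = g z"
    then have "(\<Sum>h | (h, i) \<in> \<E>. f h) = (\<Sum>h | (h, i) \<in> \<E>. g h)"
      using edge_less by (intro sum.cong) auto
    then show "(r = orth_proj (U i)
          ((2 / real (deg \<E> i)) *\<^sub>R (\<Sum>h | (h, i) \<in> \<E>. f h) + (1 / real (deg \<E> i)) *\<^sub>R lift_mat Z w $ i))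
       = (r = orth_proj (U i)
          ((2 / real (deg \<E> i)) *\<^sub>R (\<Sum>h | (h, i) \<in> \<E>. g h) + (1 / real (deg \<E> i)) *\<^sub>R lift_mat Z w $ i))"
      by simp
  qed simp
  then obtain f where "\<forall>i. f i = orth_proj (U i)
     ((2 / real (deg \<E> i)) *\<^sub>R (\<Sum>h | (h, i) \<in> \<E>. f h) + (1 / real (deg \<E> i)) *\<^sub>R lift_mat Z w $ i)" ..
  then have "sweep w (\<chi> i. f i)" unfolding sweep_iff_projection vec_lambda_beta .
  then show ?thesis ..
qed

lemma sweep_unique:
  assumes "sweep w y" "sweep w z"
  shows "y = z"
proof -
  have "y $ i = z $ i" for i
  proof (induction i rule: wf_induct_rule[OF wf_less_finite_linorder])
    case (1 i)
    then have "(\<Sum>h | (h, i) \<in> \<E>. y $ h) = (\<Sum>h | (h, i) \<in> \<E>. z $ h)"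
      using edge_less by (intro sum.cong) auto
    then show ?case using assms unfolding sweep_iff_projection by metis
  qed
  then show ?thesis by (simp add: vec_eq_iff)
qed

lemma sweep_add:
  assumes "sweep w y" "sweep w' y'"
  shows "sweep (w + w') (y + y')"
  unfolding sweep_def
proof (intro allI conjI)
  fix i
  show "(y + y') $ i \<in> U i"
    using assms subspace_U by (simp add: sweep_def subspace_add)
  let ?r = "\<lambda>w y. 2 *\<^sub>R (\<Sum>h | (h, i) \<in> \<E>. y $ h) + lift_mat Z w $ i - real (deg \<E> i) *\<^sub>R y $ i"
  have "?r (w + w') (y + y') = ?r w y + ?r w' y'"
    by (simp add: linear_add[OF linear_lift_mat] sum.distrib algebra_simps)
  also have "\<dots> \<in> (U i)\<^sup>\<bottom>"
    using assms by (intro subspace_add subspace_orthogonal_comp) (auto simp: sweep_def)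
  finally show "?r (w + w') (y + y') \<in> (U i)\<^sup>\<bottom>" .
qed

lemma sweep_scale:
  assumes "sweep w y"
  shows "sweep (c *\<^sub>R w) (c *\<^sub>R y)"
  unfolding sweep_def
proof (intro allI conjI)
  fix i
  show "(c *\<^sub>R y) $ i \<in> U i"
    using assms subspace_U by (simp add: sweep_def subspace_scale)
  let ?r = "\<lambda>w y. 2 *\<^sub>R (\<Sum>h | (h, i) \<in> \<E>. y $ h) + lift_mat Z w $ i - real (deg \<E> i) *\<^sub>R y $ i"
  have "?r (c *\<^sub>R w) (c *\<^sub>R y) = c *\<^sub>R ?r w y"
    by (simp add: linear_scale[OF linear_lift_mat] scaleR_sum_right[symmetric] algebra_simps)
  also have "\<dots> \<in> (U i)\<^sup>\<bottom>"
    using assms by (intro subspace_scale subspace_orthogonal_comp) (auto simp: sweep_def)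
  finally show "?r (c *\<^sub>R w) (c *\<^sub>R y) \<in> (U i)\<^sup>\<bottom>" .
qed

text \<open>
  Testing the inclusion at vertex \<open>i\<close> with \<open>y $ i \<in> U i\<close> removes the normal component; the
  sum over \<open>i\<close> is the energy of the graph.
\<close>

lemma sweep_energy:
  assumes "sweep w y"
  shows "inner (lift_mat (transpose Z) y) w = edge_energy \<E> y"
proof -
  have "inner (y $ i) (lift_mat Z w $ i)
      = real (deg \<E> i) * (norm (y $ i))\<^sup>2 - 2 * (\<Sum>h | (h, i) \<in> \<E>. inner (y $ h) (y $ i))" for i
  proof -
    have "inner (y $ i) (2 *\<^sub>R (\<Sum>h | (h, i) \<in> \<E>. y $ h) + lift_mat Z w $ i - real (deg \<E> i) *\<^sub>R y $ i) = 0"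
      using assms unfolding sweep_def orthogonal_comp_iff by blast
    then show ?thesis
      by (simp add: inner_add_right inner_diff_right inner_sum_right power2_norm_eq_inner inner_commute)
  qed
  then have "inner y (lift_mat Z w) = (\<Sum>i\<in>UNIV. real (deg \<E> i) * (norm (y $ i))\<^sup>2)
      - 2 * (\<Sum>(i, j)\<in>\<E>. inner (y $ i) (y $ j))"
    by (simp add: inner_vec_def sum_subtractf sum_distrib_left[symmetric] sum_edges_in)
  then show ?thesis by (simp add: inner_lift_mat_transpose edge_energy_eq)
qed

text \<open>
  One step of the algorithm replaces \<open>w\<close> by \<open>w - \<theta> * displacement w\<close>.
\<close>

definition displacement :: "'a ^ 'm \<Rightarrow> 'a ^ 'm" where
  "displacement w = lift_mat (transpose Z) (THE y. sweep w y)"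

lemma displacement_eq: "sweep w y \<Longrightarrow> displacement w = lift_mat (transpose Z) y"
  unfolding displacement_def using sweep_unique by (metis the_equality)

lemma linear_displacement: "linear displacement"
proof (rule linearI)
  fix w w' :: "'a ^ 'm" and c :: real
  obtain y y' where y: "sweep w y" and y': "sweep w' y'" using sweep_exists by metis
  show "displacement (w + w') = displacement w + displacement w'"
    using displacement_eq[OF sweep_add[OF y y']] displacement_eq[OF y] displacement_eq[OF y'] linear_add[OF linear_lift_mat] by metis
  show "displacement (c *\<^sub>R w) = c *\<^sub>R displacement w"
    using displacement_eq[OF sweep_scale[OF y]] displacement_eq[OF y] linear_scale[OF linear_lift_mat] by metis
qed

text \<open>
  \<open>\<parallel>Z\<^sup>T y\<parallel>\<^sup>2\<close> is the energy over \<open>\<E>'\<close>, and \<open>\<langle>Z\<^sup>T y, w\<rangle>\<close> the energy over the larger edge set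
  \<open>\<E>\<close>; this comparison is where the spanning subgraph enters.
\<close>

lemma displacement_firmly_nonexpansive: "(norm (displacement w))\<^sup>2 \<le> inner (displacement w) w"
proof -
  obtain y where y: "sweep w y" using sweep_exists by metis
  show ?thesis
    using edge_energy_mono[OF subgraph, of y]
    by (simp add: displacement_eq[OF y] norm_transpose_eq_edge_energy sweep_energy[OF y])
qed

text \<open>
  The space \<open>E\<close> of the theorem, described by linear equations.  In this form it is clearly a closed
  subspace.
\<close>

definition kernel_part :: "('a ^ 'm) set" where
  "kernel_part = {e. \<forall>i. lift_mat Z e $ i \<in> (U i)\<^sup>\<bottom>}"

text \<open>
  The range of \<open>Z\<close> on \<open>H\<^sup>m\<close> consists of the vectors with zero sum, i.e. of the orthogonal complement
  of the diagonal, and there the Moore--Penrose inverse really inverts \<open>Z\<close>.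
\<close>

lemma kernel_part_eq: "lift_mat (moore_penrose Z) ` ((product_space U)\<^sup>\<bottom> \<inter> diagonal_space\<^sup>\<bottom>) = kernel_part"
proof -
  have U: "w \<in> (product_space U)\<^sup>\<bottom> \<longleftrightarrow> (\<forall>i. w $ i \<in> (U i)\<^sup>\<bottom>)" for w :: "'a ^ 'n::{finite,linorder}"
    by (rule product_space_orthogonal_comp) (simp add: subspace_0 subspace_U)
  show ?thesis
  proof safe
    fix w :: "'a ^ 'n::{finite,linorder}"
    assume "w \<in> (product_space U)\<^sup>\<bottom>" "w \<in> diagonal_space\<^sup>\<bottom>"
    then show "lift_mat (moore_penrose Z) w \<in> kernel_part"
      by (simp add: kernel_part_def U diagonal_space_orthogonal_comp lift_mat_pinv_right)
  next
    fix e assume "e \<in> kernel_part"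
    then have "lift_mat Z e \<in> (product_space U)\<^sup>\<bottom> \<inter> diagonal_space\<^sup>\<bottom>"
      by (simp add: kernel_part_def U diagonal_space_orthogonal_comp sum_lift_mat)
    then show "e \<in> lift_mat (moore_penrose Z) ` ((product_space U)\<^sup>\<bottom> \<inter> diagonal_space\<^sup>\<bottom>)"
      by (metis imageI lift_mat_pinv_left)
  qed
qed

lemma subspace_kernel_part: "subspace kernel_part"
  unfolding kernel_part_def
  by (rule subspaceI)
    (auto simp: linear_0[OF linear_lift_mat] linear_add[OF linear_lift_mat] linear_scale[OF linear_lift_mat]
      intro: subspace_0 subspace_add subspace_scale subspace_orthogonal_comp)

lemma closed_kernel_part: "closed kernel_part"
proof -
  have "kernel_part = (\<Inter>i. \<Inter>s\<in>U i. {e. inner s (lift_mat Z e $ i) = 0})"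
    by (auto simp: kernel_part_def orthogonal_comp_iff)
  also have "closed \<dots>"
    unfolding lift_mat_nth by (intro closed_INT ballI closed_Collect_eq continuous_intros)
  finally show ?thesis .
qed

text \<open>
  For a constant sweep the inclusion at vertex \<open>i\<close> reads
  \<open>2 d\<^sub>i\<^sup>i\<^sup>n u + (Z w)\<^sub>i - d\<^sub>i u \<in> (U i)\<^sup>\<bottom>\<close>.  Because \<open>d\<^sub>i - 2 d\<^sub>i\<^sup>i\<^sup>n\<close> is the degree balance
  \<open>(Z balance_coeff)\<^sub>i\<close>, the part of \<open>w\<close> along \<open>balance_coeff\<close> cancels the multiples of \<open>u\<close>.
\<close>

lemma sweep_fixed_point:
  assumes u: "\<And>i. u \<in> U i" and e: "e \<in> kernel_part"
  shows "sweep (tensor_vec balance_coeff u + e) (\<chi> i. u)"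
proof -
  have "2 *\<^sub>R (\<Sum>h | (h, i) \<in> \<E>. u) + (tensor_vec (degree_balance \<E>) u) $ i - real (deg \<E> i) *\<^sub>R u = 0" for i
  proof -
    let ?a = "real (in_deg \<E> i)" and ?b = "real (out_deg \<E> i)"
    have "2 *\<^sub>R (?a *\<^sub>R u) + (?b - ?a) *\<^sub>R u - (?a + ?b) *\<^sub>R u = (2 * ?a + (?b - ?a) - (?a + ?b)) *\<^sub>R u"
      by (simp only: scaleR_left_distrib scaleR_left_diff_distrib scaleR_scaleR)
    then show ?thesis
      by (simp add: tensor_vec_def degree_balance_def deg_def sum_constant_scaleR in_deg_def)
  qed
  then have "2 *\<^sub>R (\<Sum>h | (h, i) \<in> \<E>. u) + lift_mat Z (tensor_vec balance_coeff u + e) $ i - real (deg \<E> i) *\<^sub>R u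
      = lift_mat Z e $ i" for i
    by (simp add: linear_add[OF linear_lift_mat] lift_mat_tensor_vec mult_balance_coeff algebra_simps)
  then show ?thesis using u e by (simp add: sweep_def kernel_part_def)
qed

lemma displacement_fixed_point:
  assumes u: "\<And>i. u \<in> U i" and e: "e \<in> kernel_part"
  shows "displacement (tensor_vec balance_coeff u + e) = 0"
  using displacement_eq[OF sweep_fixed_point[OF u e]] lift_transpose_zero_iff[of "\<chi> i. u"] by simp

text \<open>
  A zero displacement forces the sweep to be constant because \<open>\<E>'\<close> is connected.  Subtracting
  the sweep of \<open>tensor_vec balance_coeff u\<close> leaves the zero sweep, whose starting points form
  \<open>kernel_part\<close>.
\<close>

lemma displacement_zero_imp:
  assumes "displacement z = 0"
  shows "\<exists>u e. (\<forall>i. u \<in> U i) \<and> e \<in> kernel_part \<and> z = tensor_vec balance_coeff u + e"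
proof -
  obtain y where y: "sweep z y" using sweep_exists by metis
  then have "lift_mat (transpose Z) y = 0" using displacement_eq[OF y] assms by simp
  then obtain u where u: "\<And>i. y $ i = u"
    unfolding lift_transpose_zero_iff by metis
  then have uU: "u \<in> U i" for i using y by (metis sweep_def)
  have y: "sweep z (\<chi> i. u)" using y u by (metis vec_lambda_unique)
  have "sweep (- tensor_vec balance_coeff u) (- (\<chi> i. u))"
    using sweep_scale[OF sweep_fixed_point[of u 0], of "-1"] uU subspace_kernel_part by (simp add: subspace_0)
  from sweep_add[OF y this] have "sweep (z - tensor_vec balance_coeff u) 0" by simp
  then have "z - tensor_vec balance_coeff u \<in> kernel_part" by (simp add: sweep_def kernel_part_def)
  then show ?thesis using uU by (metis add.commute diff_add_cancel)
qed

text \<open>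
  The two summands of the kernel are orthogonal: every component of \<open>e\<close> is a linear combination
  of the components of \<open>Z e\<close>, and these are all orthogonal to the intersection of the \<open>U i\<close>.
\<close>

lemma inner_tensor_kernel_part:
  assumes u: "\<And>i. u \<in> U i" and e: "e \<in> kernel_part"
  shows "inner (lift_adj balance_coeff e) u = 0"
proof -
  have "inner (e $ j) u = 0" for j
  proof -
    have "e $ j = (\<Sum>i\<in>UNIV. moore_penrose Z $ j $ i *\<^sub>R lift_mat Z e $ i)"
      by (metis lift_mat_nth lift_mat_pinv_left)
    moreover have "inner (lift_mat Z e $ i) u = 0" for i
      using u[of i] e by (auto simp: kernel_part_def orthogonal_comp_iff inner_commute)
    ultimately show ?thesis by (simp add: inner_sum_left)
  qed
  then show ?thesis by (simp add: lift_adj_def inner_sum_left)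
qed

text \<open>
  Since the kernel is an orthogonal sum, the projection onto it is the sum of the projections;
  the factor \<open>1 / (norm balance_coeff)\<^sup>2\<close> normalises the map \<open>tensor_vec balance_coeff\<close>, which
  multiplies norms by \<open>norm balance_coeff\<close>.
\<close>

lemma projection_onto_kernel:
  fixes v0 :: "'a ^ 'm"
  defines "u \<equiv> (1 / (norm balance_coeff)\<^sup>2) *\<^sub>R orth_proj (\<Inter>i. U i) (lift_adj balance_coeff v0)"
    and "e \<equiv> orth_proj kernel_part v0"
  shows "\<And>i. u \<in> U i" and "e \<in> kernel_part"
    and "displacement z = 0 \<Longrightarrow> inner (v0 - (tensor_vec balance_coeff u + e)) z = 0"
proof -
  let ?U = "\<Inter>i. U i"
  have U: "subspace ?U" "closed ?U"
    using subspace_U closed_U by (auto intro: subspace_Inter)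
  have uU: "u \<in> ?U" unfolding u_def by (intro subspace_scale U orth_proj_mem)
  then show u: "u \<in> U i" for i by blast
  show e: "e \<in> kernel_part" unfolding e_def by (intro orth_proj_mem subspace_kernel_part closed_kernel_part)
  assume "displacement z = 0"
  then obtain u' e' where u': "\<And>i. u' \<in> U i" and e': "e' \<in> kernel_part" and z: "z = tensor_vec balance_coeff u' + e'"
    using displacement_zero_imp by blast
  have "lift_adj balance_coeff v0 - (norm balance_coeff)\<^sup>2 *\<^sub>R u \<in> ?U\<^sup>\<bottom>"
    using orth_proj_residual[OF U, of "lift_adj balance_coeff v0"] balance_coeff_nonzero by (simp add: u_def)
  then have "inner (lift_adj balance_coeff v0 - (norm balance_coeff)\<^sup>2 *\<^sub>R u) u' = 0"
    using u' by (auto simp: orthogonal_comp_iff inner_commute)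
  then have 1: "inner (v0 - tensor_vec balance_coeff u) (tensor_vec balance_coeff u') = 0"
    by (subst inner_diff_left) (simp add: inner_diff_left inner_tensor_vec lift_adj_tensor_vec)
  have 2: "inner (v0 - e) e' = 0"
    using orth_proj_residual[OF subspace_kernel_part closed_kernel_part, of v0] e'
    by (auto simp: e_def orthogonal_comp_iff inner_commute)
  have 3: "inner e (tensor_vec balance_coeff u') = 0" "inner (tensor_vec balance_coeff u) e' = 0"
    using inner_tensor_kernel_part[OF u' e] inner_tensor_kernel_part[OF u e']
    by (simp_all add: inner_tensor_vec inner_commute[of "tensor_vec balance_coeff u"])
  show "inner (v0 - (tensor_vec balance_coeff u + e)) z = 0"
    using 1 2 3 unfolding z by (simp add: inner_diff_left inner_add_left inner_add_right)
qed

text \<open>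
  Sweeping is continuous, by the same recursion along the vertices.
\<close>

lemma sweep_tendsto:
  assumes sw: "\<And>k. sweep (w k) (y k)" and w: "w \<longlonglongrightarrow> w'" and y': "sweep w' y'"
  shows "(\<lambda>k. y k $ i) \<longlonglongrightarrow> y' $ i"
proof (induction i rule: wf_induct_rule[OF wf_less_finite_linorder])
  case (1 i)
  let ?g = "\<lambda>w y. (2 / real (deg \<E> i)) *\<^sub>R (\<Sum>h | (h, i) \<in> \<E>. y $ h) + (1 / real (deg \<E> i)) *\<^sub>R lift_mat Z w $ i"
  have "(\<lambda>k. ?g (w k) (y k)) \<longlonglongrightarrow> ?g w' y'"
  proof (intro tendsto_add tendsto_scaleR tendsto_const)
    show "(\<lambda>k. \<Sum>h | (h, i) \<in> \<E>. y k $ h) \<longlonglongrightarrow> (\<Sum>h | (h, i) \<in> \<E>. y' $ h)"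
      by (rule tendsto_sum) (use 1 edge_less in auto)
    show "(\<lambda>k. lift_mat Z (w k) $ i) \<longlonglongrightarrow> lift_mat Z w' $ i"
      unfolding lift_mat_nth using w by (intro tendsto_intros)
  qed
  then have "(\<lambda>k. orth_proj (U i) (?g (w k) (y k))) \<longlonglongrightarrow> orth_proj (U i) (?g w' y')"
    by (intro tendsto_orth_proj subspace_U closed_U)
  moreover have "orth_proj (U i) (?g (w k) (y k)) = y k $ i" for k
    using sw[of k] unfolding sweep_iff_projection by metis
  moreover have "orth_proj (U i) (?g w' y') = y' $ i"
    using y' unfolding sweep_iff_projection by metis
  ultimately show ?case by simp
qed

end

section \<open>Strong convergence\<close>

theorem theorem4p8:
  fixes U :: "'n::{finite,linorder} \<Rightarrow> 'a::{real_inner,complete_space} set"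
    and A :: "'n \<Rightarrow> 'a \<Rightarrow> 'a set"
    and \<E> \<E>' :: "('n \<times> 'n) set"
    and Z :: "real ^ 'm::finite ^ 'n::{finite,linorder}"
    and \<theta> :: real
    and x :: "nat \<Rightarrow> 'a ^ 'n::{finite,linorder}"
    and v :: "nat \<Rightarrow> 'a ^ 'm"
    and v0 :: "'a ^ 'm"
    and \<alpha> :: "real ^ 'm"
    and E :: "('a ^ 'm) set"
    and u_tilde :: 'a
    and e_tilde :: "'a ^ 'm"
  assumes "CARD('m) = CARD('n) - 1"
    and "\<And>i. subspace (U i)" and "\<And>i. closed (U i)"
    and "\<And>i. A i = normal_cone (U i)"
    and "algorithmic_graph \<E>"
    and "\<E>' \<subseteq> \<E>" and "connected_graph \<E>'"
    and "Lap \<E>' = Z ** transpose Z"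
    and "0 < \<theta>" and "\<theta> < 2"
    and "v 0 = v0"
    and "\<And>k i. x (Suc k) $ i =
           resolvent (op_scale (1 / real (deg \<E> i)) (A i))
             ((2 / real (deg \<E> i)) *\<^sub>R (\<Sum>h | (h, i) \<in> \<E>. x (Suc k) $ h)
              + (1 / real (deg \<E> i)) *\<^sub>R (\<Sum>j\<in>UNIV. Z $ i $ j *\<^sub>R v k $ j))"
    and "\<And>k i. v (Suc k) $ i = v k $ i - \<theta> *\<^sub>R (\<Sum>j\<in>UNIV. Z $ j $ i *\<^sub>R x (Suc k) $ j)"
    and "\<alpha> = moore_penrose Z *v degree_balance \<E>"
    and "E = lift_mat (moore_penrose Z) ` ((product_space U)\<^sup>\<bottom> \<inter> diagonal_space\<^sup>\<bottom>)"
    and "u_tilde = (1 / (norm \<alpha>)\<^sup>2) *\<^sub>R orth_proj (\<Inter>i. U i) (lift_adj \<alpha> v0)"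
    and "e_tilde = orth_proj E v0"
  shows "(\<forall>i. (\<lambda>k. x k $ i) \<longlonglongrightarrow> u_tilde) \<and>
         (\<forall>i. (\<lambda>k. v k $ i) \<longlonglongrightarrow> \<alpha> $ i *\<^sub>R u_tilde + e_tilde $ i)"
proof -
  interpret subspace_splitting \<E> \<E>' Z U
    using assms(1-3,5-8) by unfold_locales auto
  have alpha: "\<alpha> = balance_coeff" using assms(14) by (simp add: balance_coeff_def)
  define p where "p = tensor_vec \<alpha> u_tilde + e_tilde"
  have u: "u_tilde = (1 / (norm balance_coeff)\<^sup>2) *\<^sub>R orth_proj (\<Inter>i. U i) (lift_adj balance_coeff v0)"
    using assms(16) alpha by simp
  have e: "e_tilde = orth_proj kernel_part v0" using assms(15,17) kernel_part_eq by simp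
  note proj = projection_onto_kernel[where ?v0.0 = v0, folded u e, folded alpha]
  have sw: "sweep (v k) (x (Suc k))" for k
  proof -
    have res: "resolvent (op_scale (1 / real (deg \<E> i)) (A i)) z = orth_proj (U i) z" for i z
      using assms(2-4) deg_pos[OF assms(5)] by (simp add: resolvent_normal_cone)
    show ?thesis
      unfolding sweep_iff_projection lift_mat_nth
      using assms(12)[of k] unfolding res by (rule allI)
  qed
  \<comment> \<open>Only the sequence \<open>v\<close> carries memory: \<open>x\<close> is read off from it by sweeping.\<close>
  have "v (Suc k) = v k - \<theta> *\<^sub>R displacement (v k)" for k
    using assms(13) by (simp add: vec_eq_iff displacement_eq[OF sw] lift_mat_nth transpose_def)
  moreover have sw_p: "sweep p (\<chi> i. u_tilde)" and "displacement p = 0"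
    using sweep_fixed_point[of u_tilde e_tilde] displacement_fixed_point[of u_tilde e_tilde] proj(1,2)
    by (simp_all add: p_def alpha)
  ultimately have v: "v \<longlonglongrightarrow> p"
    using assms(9,10,11) proj(3) unfolding p_def
    by (intro relaxed_linear_iteration_tendsto[OF linear_displacement displacement_firmly_nonexpansive]) auto
  have "(\<lambda>k. x k $ i) \<longlonglongrightarrow> u_tilde" for i
  proof (rule LIMSEQ_imp_Suc)
    show "(\<lambda>k. x (Suc k) $ i) \<longlonglongrightarrow> u_tilde"
      using sweep_tendsto[OF sw v sw_p, of i] by simp
  qed
  moreover have "(\<lambda>k. v k $ i) \<longlonglongrightarrow> \<alpha> $ i *\<^sub>R u_tilde + e_tilde $ i" for i
    using tendsto_vec_nth[OF v, of i] by (simp add: p_def tensor_vec_def)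
  ultimately show ?thesis by blast
qed

end
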